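(* Let $X$ be a real or complex Banach space and let $(A(n))_{n\in\mathbb{N}}$ be a sequence in $\mathcal{B}(X)$. The linear discrete-time system $x_{n+1}=A(n)x_n$, $n\in\mathbb{N}$, is nonuniformly power instable (NPIS) if and only if there are two nondecreasing sequences $\varphi,\tau:\mathbb{N}\to[1,\infty)$ with $\lim_{n\to\infty}\tau(n)=\infty$ such that $$\tau(m-n)\,\|x\|\le \varphi(m)\,\|\mathcal{A}(m,n)x\|$$ for all $(m,n,x)\in\Delta\times X$.
   Context: $\mathcal{B}(X)$ is the space of bounded linear operators on $X$; $\|\cdot\|$ denotes the norm on $X$. $\mathbb{N}=\{0,1,2,\dots\}$ and $\Delta=\{(m,n)\in\mathbb{N}^2: m\ge n\}$. For $(m,n)\in\Delta$, $\mathcal{A}(m,n)=A(m-1)\cdots A(n)$ if $m\ge n+1$ and $\mathcal{A}(n,n)=I$ (the identity). The system is nonuniformly power instable (NPIS) if there exist a nondecreasing sequence $N:\mathbb{N}\to[1,\infty)$ and $r\in(0,1)$ such that $\|\mathcal{A}(n,l)x\|\le N(m)\,r^{m-n}\,\|\mathcal{A}(m,l)x\|$ for all $m,n,l\in\mathbb{N}$ with $m\ge n\ge l$ and all $x\in X$. *)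

theory Defs
  imports "HOL-Analysis.Bounded_Linear_Function"
begin

text \<open>
  Class \<open>banach\<close> provides the real scalars. A complex Banach space is in particular a real one
  (same norm), and its bounded complex-linear operators are bounded real-linear; the notions below
  involve only the norm and operator composition, so they are insensitive to the scalar field.
\<close>

text \<open>
  \<open>evolution A m n\<close> is \<open>A (m - 1) \<cdots> A n\<close> for \<open>m > n\<close> and the identity for \<open>m = n\<close>.
  The value for \<open>m < n\<close> is a dummy (the identity) and is never used.
\<close>

primrec evolution :: "(nat \<Rightarrow> 'a::real_normed_vector \<Rightarrow>\<^sub>L 'a) \<Rightarrow> nat \<Rightarrow> nat \<Rightarrow> 'a \<Rightarrow>\<^sub>L 'a" where
  "evolution A 0 n = id_blinfun"
| "evolution A (Suc m) n = (if n \<le> m then A m o\<^sub>L evolution A m n else id_blinfun)"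

definition nonuniformly_power_instable :: "(nat \<Rightarrow> 'a::real_normed_vector \<Rightarrow>\<^sub>L 'a) \<Rightarrow> bool" where
  "nonuniformly_power_instable A \<longleftrightarrow>
    (\<exists>(N :: nat \<Rightarrow> real) (r :: real).
      mono N \<and> (\<forall>n. 1 \<le> N n) \<and> 0 < r \<and> r < 1 \<and>
      (\<forall>m n l x. m \<ge> n \<longrightarrow> n \<ge> l \<longrightarrow>
        norm (evolution A n l x) \<le> N m * r ^ (m - n) * norm (evolution A m l x)))"

end

theory Submission imports Defs begin

text \<open>
  Write \<open>\<A>(m, n)\<close> for \<open>evolution A m n\<close>.

  From left to right, the case \<open>l = n\<close> of instability (where the operator on the left is the
  identity), divided by \<open>r ^ (m - n)\<close>, is the required estimate, with \<open>\<phi> = N\<close> and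
  \<open>\<tau> k = (1 / r) ^ k\<close>.

  From right to left, the point is that \<open>N\<close> is allowed to depend on the final time \<open>m\<close>. Because
  \<open>1 \<le> \<tau> (m - n)\<close>, the growth estimate implies that \<open>\<A>(m, n)\<close> shrinks norms at most by the factor
  \<open>\<phi> m\<close>. An exponential rate can be inserted into this bound, since \<open>2 ^ (m - n)\<close> never exceeds
  \<open>2 ^ m\<close>: so \<open>r = 1 / 2\<close> and \<open>N m = \<phi> m * 2 ^ m\<close> work
  (\<open>nonuniformly_power_instable_if_bounded_below\<close>). The initial time \<open>l\<close> enters through the cocycle
  identity \<open>\<A>(m, n) (\<A>(n, l) x) = \<A>(m, l) x\<close>: the bound for \<open>\<A>(m, n)\<close> is applied to the
  vector \<open>\<A>(n, l) x\<close>.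
\<close>

lemma evolution_self [simp]: "evolution A n n = id_blinfun"
  by (cases n) auto

lemma evolution_cocycle:
  assumes "l \<le> n" and "n \<le> m"
  shows "blinfun_apply (evolution A m n) (evolution A n l x) = evolution A m l x"
  using \<open>n \<le> m\<close> \<open>l \<le> n\<close> by (induction m rule: dec_induct) auto

text \<open>
  A lower bound without any growth rate already gives the exponential one: for a fixed final time
  \<open>m\<close> there are only finitely many starting times \<open>n \<le> m\<close>, so the factor \<open>2 ^ (m - n)\<close> stays below
  the constant \<open>2 ^ m\<close>, which is absorbed into \<open>N m\<close>.
\<close>

lemma nonuniformly_power_instable_if_bounded_below:
  fixes A :: "nat \<Rightarrow> 'a::real_normed_vector \<Rightarrow>\<^sub>L 'a" and \<phi> :: "nat \<Rightarrow> real"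
  assumes mono: "mono \<phi>" and ge1: "\<And>n. 1 \<le> \<phi> n"
    and below: "\<And>m n x. n \<le> m \<Longrightarrow> norm x \<le> \<phi> m * norm (evolution A m n x)"
  shows "nonuniformly_power_instable A"
proof -
  define N :: "nat \<Rightarrow> real" where "N m = \<phi> m * 2 ^ m" for m
  have pos: "0 \<le> \<phi> m" for m
    using ge1[of m] by linarith
  have "mono N"
    unfolding N_def by (intro monoI mult_mono) (auto simp: monoD[OF mono] pos)
  moreover have "1 \<le> N m" for m
    using mult_mono[OF ge1[of m], of 1 "2 ^ m"] pos[of m] by (simp add: N_def)
  moreover have "norm (evolution A n l x) \<le> N m * (1 / 2) ^ (m - n) * norm (evolution A m l x)"
    if "n \<le> m" "l \<le> n" for m n l x
  proof -
    have "2 ^ m * (1 / 2 :: real) ^ (m - n) = 2 ^ n"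
      using \<open>n \<le> m\<close> by (simp add: power_diff power_divide)
    then have rate: "1 \<le> 2 ^ m * (1 / 2 :: real) ^ (m - n)"
      by simp
    have "norm (evolution A n l x) \<le> \<phi> m * norm (evolution A m l x)"
      using below[OF \<open>n \<le> m\<close>, of "evolution A n l x"] that by (simp add: evolution_cocycle)
    also have "\<dots> \<le> (\<phi> m * norm (evolution A m l x)) * (2 ^ m * (1 / 2) ^ (m - n))"
      using mult_left_mono[OF rate, of "\<phi> m * norm (evolution A m l x)"] pos[of m] by simp
    finally show ?thesis
      by (simp add: N_def mult_ac)
  qed
  ultimately show ?thesis
    unfolding nonuniformly_power_instable_def
    by (intro exI[of _ N] exI[of _ "1 / 2"]) auto
qed

theorem proposition1:
  fixes A :: "nat \<Rightarrow> 'a::banach \<Rightarrow>\<^sub>L 'a"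
  shows "nonuniformly_power_instable A \<longleftrightarrow>
    (\<exists>(\<phi> :: nat \<Rightarrow> real) (\<tau> :: nat \<Rightarrow> real).
      mono \<phi> \<and> mono \<tau> \<and> (\<forall>n. 1 \<le> \<phi> n) \<and> (\<forall>n. 1 \<le> \<tau> n) \<and>
      filterlim \<tau> at_top sequentially \<and>
      (\<forall>m n x. m \<ge> n \<longrightarrow> \<tau> (m - n) * norm x \<le> \<phi> m * norm (evolution A m n x)))"
    (is "_ \<longleftrightarrow> ?growth")
proof
  assume "nonuniformly_power_instable A"
  then obtain N :: "nat \<Rightarrow> real" and r :: real
    where N: "mono N" "\<And>n. 1 \<le> N n" and r: "0 < r" "r < 1"
      and inst: "\<And>m n l x. n \<le> m \<Longrightarrow> l \<le> n \<Longrightarrow>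
        norm (evolution A n l x) \<le> N m * r ^ (m - n) * norm (evolution A m l x)"
    unfolding nonuniformly_power_instable_def by auto
  define \<tau> where "\<tau> k = inverse r ^ k" for k
  have inv: "1 < inverse r"
    using r by (simp add: one_less_inverse)
  have "mono \<tau>"
    unfolding \<tau>_def by (intro monoI power_increasing) (use inv in auto)
  moreover have "1 \<le> \<tau> k" for k
    unfolding \<tau>_def using inv by (intro one_le_power) simp
  moreover have "filterlim \<tau> at_top sequentially"
    unfolding \<tau>_def
  proof (rule filterlim_at_infinity_imp_filterlim_at_top)
    show "filterlim ((^) (inverse r)) at_infinity sequentially"
      using inv r by (intro filterlim_realpow_sequentially_gt1) simp
    show "\<forall>\<^sub>F k in sequentially. 0 < inverse r ^ k"
      using r by simp
  qed
  moreover have "\<tau> (m - n) * norm x \<le> N m * norm (evolution A m n x)" if "n \<le> m" for m n x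
  proof -
    have "norm x \<le> r ^ (m - n) * (N m * norm (evolution A m n x))"
      using inst[OF that order_refl, of x] by (simp add: mult_ac)
    then show ?thesis
      using r by (simp add: \<tau>_def power_inverse field_simps)
  qed
  ultimately show ?growth
    using N by (intro exI[of _ N] exI[of _ \<tau>]) auto
next
  assume ?growth
  then obtain \<phi> \<tau> :: "nat \<Rightarrow> real"
    where \<phi>: "mono \<phi>" "\<And>n. 1 \<le> \<phi> n" and \<tau>: "\<And>n. 1 \<le> \<tau> n"
      and growth: "\<And>m n x. n \<le> m \<Longrightarrow> \<tau> (m - n) * norm x \<le> \<phi> m * norm (evolution A m n x)"
    by blast
  have "norm x \<le> \<phi> m * norm (evolution A m n x)" if "n \<le> m" for m n x
    using mult_right_mono[OF \<tau>[of "m - n"] norm_ge_zero[of x]] growth[OF that, of x] by simp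
  with \<phi> show "nonuniformly_power_instable A"
    by (rule nonuniformly_power_instable_if_bounded_below)
qed

end
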